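(* Let $\mathbf{H}$ be the field of quaternions and let $G_{2,\mathbf{H}}=\{\alpha\in \mathrm{Iso}_{\mathbf{R}}(\mathbf{H}) \mid \alpha(xy)=(\alpha x)(\alpha y)\ \text{for all } x,y\in\mathbf{H}\}$. Then $G_{2,\mathbf{H}}$ is isomorphic to the group $Sp(1)/\mathbf{Z}_2$, where $\mathbf{Z}_2=\{1,-1\}$: $G_{2,\mathbf{H}}\cong Sp(1)/\mathbf{Z}_2$.
   Context: $\mathrm{Iso}_{\mathbf{R}}(\mathbf{H})$ is the group of $\mathbf{R}$-linear isomorphisms of $\mathbf{H}$ onto itself. $Sp(1)=\{q\in\mathbf{H}\mid q\overline{q}=1\}$. *)

theory Defs
  imports Complex_Main "HOL-Algebra.Coset"
begin

datatype quat = Quat (Qre: real) (Qi: real) (Qj: real) (Qk: real)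

lemma quat_eq_iff: "x = y \<longleftrightarrow> Qre x = Qre y \<and> Qi x = Qi y \<and> Qj x = Qj y \<and> Qk x = Qk y"
  by (auto intro: quat.expand)

instantiation quat :: real_algebra_1
begin

definition "0 = Quat 0 0 0 0"
definition "1 = Quat 1 0 0 0"
definition "x + y = Quat (Qre x + Qre y) (Qi x + Qi y) (Qj x + Qj y) (Qk x + Qk y)"
definition "- x = Quat (- Qre x) (- Qi x) (- Qj x) (- Qk x)"
definition "x - y = Quat (Qre x - Qre y) (Qi x - Qi y) (Qj x - Qj y) (Qk x - Qk y)"
definition "r *\<^sub>R x = Quat (r * Qre x) (r * Qi x) (r * Qj x) (r * Qk x)"

(* Hamilton's product for the basis 1, i, j, k: i^2 = j^2 = k^2 = ijk = -1. *)
definition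
  "x * y = Quat
    (Qre x * Qre y - Qi x * Qi y - Qj x * Qj y - Qk x * Qk y)
    (Qre x * Qi y + Qi x * Qre y + Qj x * Qk y - Qk x * Qj y)
    (Qre x * Qj y - Qi x * Qk y + Qj x * Qre y + Qk x * Qi y)
    (Qre x * Qk y + Qi x * Qj y - Qj x * Qi y + Qk x * Qre y)"

lemmas quat_defs = zero_quat_def one_quat_def plus_quat_def uminus_quat_def minus_quat_def
  scaleR_quat_def times_quat_def

instance
  by standard (simp_all add: quat_defs algebra_simps)

end

definition qcnj :: "quat \<Rightarrow> quat"
  where "qcnj x = Quat (Qre x) (- Qi x) (- Qj x) (- Qk x)"

definition qnorm2 :: "quat \<Rightarrow> real"
  where "qnorm2 x = (Qre x)\<^sup>2 + (Qi x)\<^sup>2 + (Qj x)\<^sup>2 + (Qk x)\<^sup>2"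

lemma mult_qcnj: "x * qcnj x = qnorm2 x *\<^sub>R 1" "qcnj x * x = qnorm2 x *\<^sub>R 1"
  by (simp_all add: qcnj_def qnorm2_def quat_defs power2_eq_square algebra_simps)

lemma qcnj_mult: "qcnj (x * y) = qcnj y * qcnj x"
  by (simp add: qcnj_def quat_defs algebra_simps)

lemma qcnj_qcnj [simp]: "qcnj (qcnj x) = x"
  by (simp add: qcnj_def)

lemma qcnj_one [simp]: "qcnj 1 = 1" "qcnj (- 1) = - 1"
  by (simp_all add: qcnj_def quat_defs)

lemma qnorm2_eq_0_iff: "qnorm2 x = 0 \<longleftrightarrow> x = 0"
  by (auto simp: qnorm2_def zero_quat_def quat_eq_iff add_nonneg_eq_0_iff)

instantiation quat :: real_div_algebra
begin

definition "inverse x = inverse (qnorm2 x) *\<^sub>R qcnj x"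
definition "x div y = x * inverse (y :: quat)"

instance
proof
  fix x y :: quat
  show "inverse x * x = 1" if "x \<noteq> 0"
  proof -
    have "inverse x * x = inverse (qnorm2 x) *\<^sub>R (qcnj x * x)"
      by (simp add: inverse_quat_def)
    also have "\<dots> = 1"
      using that by (simp add: mult_qcnj(2) qnorm2_eq_0_iff)
    finally show ?thesis .
  qed
  show "x * inverse x = 1" if "x \<noteq> 0"
  proof -
    have "x * inverse x = inverse (qnorm2 x) *\<^sub>R (x * qcnj x)"
      by (simp add: inverse_quat_def)
    also have "\<dots> = 1"
      using that by (simp add: mult_qcnj(1) qnorm2_eq_0_iff)
    finally show ?thesis .
  qed
  show "x div y = x * inverse y"
    by (rule divide_quat_def)
  have "qcnj 0 = 0" by (simp add: qcnj_def zero_quat_def)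
  then show "inverse (0 :: quat) = 0"
    by (simp add: inverse_quat_def)
qed

end

definition IsoR_H :: "(quat \<Rightarrow> quat) monoid"
  where "IsoR_H = \<lparr>carrier = {f. linear f \<and> bij f}, mult = (\<circ>), one = id\<rparr>"

definition G2_H :: "(quat \<Rightarrow> quat) monoid"
  where "G2_H = IsoR_H\<lparr>carrier := {\<alpha> \<in> carrier IsoR_H. \<forall>x y. \<alpha> (x * y) = \<alpha> x * \<alpha> y}\<rparr>"

definition Sp1 :: "quat monoid"
  where "Sp1 = \<lparr>carrier = {q. q * qcnj q = 1}, mult = (*), one = 1\<rparr>"

definition Z2_H :: "quat set"
  where "Z2_H = {1, - 1}"

lemma group_IsoR_H: "group IsoR_H"
proof (rule groupI)
  fix f assume "f \<in> carrier IsoR_H"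
  then have f: "linear f" "bij f" by (auto simp: IsoR_H_def)
  define g where "g = inv_into UNIV f"
  have gf: "g (f x) = x" and fg: "f (g x) = x" for x
    using f(2) by (simp_all add: g_def bij_is_inj bij_is_surj surj_f_inv_f)
  have "g (x + y) = g x + g y" for x y
    using gf[of "g x + g y"] by (simp add: linear_add[OF f(1)] fg)
  moreover have "g (r *\<^sub>R x) = r *\<^sub>R g x" for r x
    using gf[of "r *\<^sub>R g x"] by (simp add: linear_scale[OF f(1)] fg)
  ultimately have "linear g" by (rule linearI)
  moreover have "bij g" using f(2) by (simp add: g_def bij_imp_bij_inv)
  ultimately show "\<exists>g\<in>carrier IsoR_H. g \<otimes>\<^bsub>IsoR_H\<^esub> f = \<one>\<^bsub>IsoR_H\<^esub>"
    by (intro bexI[of _ g]) (simp_all add: IsoR_H_def fun_eq_iff gf)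
qed (simp_all add: IsoR_H_def comp_assoc linear_id linear_compose bij_comp)

lemma subgroup_G2_H: "subgroup (carrier G2_H) IsoR_H"
proof (rule group.subgroupI[OF group_IsoR_H])
  fix f assume f: "f \<in> carrier G2_H"
  then have fI: "f \<in> carrier IsoR_H" by (simp add: G2_H_def)
  define g where "g = inv\<^bsub>IsoR_H\<^esub> f"
  have gI: "g \<in> carrier IsoR_H" and "g \<circ> f = id" "f \<circ> g = id"
    using group.inv_closed[OF group_IsoR_H fI] group.l_inv[OF group_IsoR_H fI]
      group.r_inv[OF group_IsoR_H fI] by (simp_all add: g_def IsoR_H_def)
  then have gf: "g (f x) = x" and fg: "f (g x) = x" for x
    by (simp_all add: fun_eq_iff)
  have "g (x * y) = g x * g y" for x y
  proof -
    have "f (g x * g y) = x * y" using f by (simp add: G2_H_def fg)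
    then show ?thesis using gf by metis
  qed
  with gI show "inv\<^bsub>IsoR_H\<^esub> f \<in> carrier G2_H" by (simp add: G2_H_def g_def)
next
  have "id \<in> carrier G2_H" by (simp add: G2_H_def IsoR_H_def linear_id)
  then show "carrier G2_H \<noteq> {}" by blast
qed (auto simp: G2_H_def IsoR_H_def linear_compose bij_comp)

lemma group_G2_H: "group G2_H"
proof -
  have "G2_H = IsoR_H\<lparr>carrier := carrier G2_H\<rparr>" by (simp add: G2_H_def)
  then show ?thesis
    using group.subgroup_imp_group[OF group_IsoR_H subgroup_G2_H] by simp
qed

lemma group_Sp1: "group Sp1"
proof (rule groupI)
  fix x y assume "x \<in> carrier Sp1" "y \<in> carrier Sp1"
  then have x: "x * qcnj x = 1" and y: "y * qcnj y = 1" by (simp_all add: Sp1_def)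
  have "(x * y) * qcnj (x * y) = x * (y * qcnj y) * qcnj x"
    by (simp only: qcnj_mult mult.assoc)
  also have "\<dots> = 1" by (simp add: x y)
  finally show "x \<otimes>\<^bsub>Sp1\<^esub> y \<in> carrier Sp1" by (simp add: Sp1_def)
next
  fix x assume "x \<in> carrier Sp1"
  then have "x * qcnj x = 1" by (simp add: Sp1_def)
  then have "qcnj x * x = 1" by (simp only: mult_qcnj)
  then show "\<exists>y\<in>carrier Sp1. y \<otimes>\<^bsub>Sp1\<^esub> x = \<one>\<^bsub>Sp1\<^esub>"
    by (intro bexI[of _ "qcnj x"]) (simp_all add: Sp1_def)
qed (simp_all add: Sp1_def mult.assoc)

lemma normal_Z2_H: "Z2_H \<lhd> Sp1"
proof -
  interpret group Sp1 by (rule group_Sp1)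
  have sub: "Z2_H \<subseteq> carrier Sp1" by (auto simp: Z2_H_def Sp1_def)
  have "inv\<^bsub>Sp1\<^esub> (- 1) = - 1"
    by (rule inv_equality) (simp_all add: Sp1_def)
  moreover have "inv\<^bsub>Sp1\<^esub> 1 = 1"
    by (rule inv_equality) (simp_all add: Sp1_def)
  ultimately have "subgroup Z2_H Sp1"
    using sub by (intro subgroupI) (auto simp: Z2_H_def Sp1_def)
  moreover have "Z2_H #>\<^bsub>Sp1\<^esub> x = x <#\<^bsub>Sp1\<^esub> Z2_H" for x
    by (simp add: Z2_H_def r_coset_def l_coset_def Sp1_def)
  ultimately show ?thesis by (auto intro: normalI)
qed

end

theory Submission
  imports Defs
begin

text \<open>
  Conjugation by unit quaternions maps \<open>Sp(1)\<close> to the automorphism group with kernel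
  \<open>{1, -1}\<close>. For surjectivity, let \<open>\<alpha>\<close> be an automorphism. Averaging over the quaternion
  group, \<open>q = t - \<alpha>(i) t i - \<alpha>(j) t j - \<alpha>(k) t k\<close> satisfies \<open>\<alpha>(x) q = q x\<close> for every \<open>t\<close>.
  Summing \<open>q t\<^sup>-\<^sup>1\<close> over \<open>t = 1, i, j, k\<close> gives \<open>4\<close>, since each of \<open>i, j, k\<close> has vanishing sum of
  conjugates, so \<open>q\<close> is nonzero for one of these \<open>t\<close>, and normalising it shows that \<open>\<alpha>\<close> is
  inner.
\<close>

definition quat_i :: quat where "quat_i = Quat 0 1 0 0"
definition quat_j :: quat where "quat_j = Quat 0 0 1 0"
definition quat_k :: quat where "quat_k = Quat 0 0 0 1"

lemmas quat_unit_defs = quat_i_def quat_j_def quat_k_def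

lemma quat_unit_mult:
  "quat_i * quat_i = - 1" "quat_j * quat_j = - 1" "quat_k * quat_k = - 1"
  "quat_i * quat_j = quat_k" "quat_j * quat_k = quat_i" "quat_k * quat_i = quat_j"
  "quat_j * quat_i = - quat_k" "quat_k * quat_j = - quat_i" "quat_i * quat_k = - quat_j"
  by (simp_all add: quat_unit_defs quat_defs)

lemma quat_basis_expansion:
  "x = Qre x *\<^sub>R 1 + Qi x *\<^sub>R quat_i + Qj x *\<^sub>R quat_j + Qk x *\<^sub>R quat_k"
  by (simp add: quat_unit_defs quat_defs)

lemma qcnj_scaleR: "qcnj (r *\<^sub>R x) = r *\<^sub>R qcnj x"
  by (simp add: qcnj_def scaleR_quat_def)

lemma qnorm2_nonneg: "0 \<le> qnorm2 x"
  by (simp add: qnorm2_def)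

lemma in_G2_H_iff:
  "f \<in> carrier G2_H \<longleftrightarrow> linear f \<and> bij f \<and> (\<forall>x y. f (x * y) = f x * f y)"
  by (simp add: G2_H_def IsoR_H_def)

lemma in_Sp1_iff: "q \<in> carrier Sp1 \<longleftrightarrow> q * qcnj q = 1"
  by (simp add: Sp1_def)

lemma Sp1_qcnj_mult: "q \<in> carrier Sp1 \<Longrightarrow> qcnj q * q = 1"
  by (simp add: in_Sp1_iff mult_qcnj)

text \<open>On \<open>Sp1\<close> the conjugate \<open>qcnj q\<close> is the inverse of
  \<open>q\<close>, so there this is an inner automorphism.\<close>

definition quat_conj :: "quat \<Rightarrow> quat \<Rightarrow> quat"
  where "quat_conj q = (\<lambda>x. q * x * qcnj q)"

lemma quat_conj_in_G2_H:
  assumes q: "q \<in> carrier Sp1"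
  shows "quat_conj q \<in> carrier G2_H"
proof -
  have r: "q * qcnj q = 1" using q by (simp add: in_Sp1_iff)
  have l: "qcnj q * q = 1" using q by (rule Sp1_qcnj_mult)
  have l': "qcnj q * (q * z) = z" for z by (simp add: l flip: mult.assoc)
  have r': "q * (qcnj q * z) = z" for z by (simp add: r flip: mult.assoc)
  have "linear (quat_conj q)"
    by (rule linearI) (simp_all add: quat_conj_def algebra_simps)
  moreover have "bij (quat_conj q)"
    by (rule o_bij[of "quat_conj (qcnj q)"])
      (simp_all add: fun_eq_iff quat_conj_def mult.assoc l l' r r')
  moreover have "quat_conj q (x * y) = quat_conj q x * quat_conj q y" for x y
    by (simp add: quat_conj_def mult.assoc l')
  ultimately show ?thesis by (simp add: in_G2_H_iff)
qed

lemma quat_conj_hom: "quat_conj \<in> hom Sp1 G2_H"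
proof (rule homI)
  show "quat_conj (p \<otimes>\<^bsub>Sp1\<^esub> q) = quat_conj p \<otimes>\<^bsub>G2_H\<^esub> quat_conj q" for p q
    by (simp add: Sp1_def G2_H_def IsoR_H_def quat_conj_def fun_eq_iff qcnj_mult mult.assoc)
qed (rule quat_conj_in_G2_H)

lemma quat_conj_kernel: "kernel Sp1 G2_H quat_conj = Z2_H"
proof (intro equalityI subsetI)
  fix q assume "q \<in> kernel Sp1 G2_H quat_conj"
  then have q: "q \<in> carrier Sp1" and c: "q * x * qcnj q = x" for x
    by (simp_all add: kernel_def G2_H_def IsoR_H_def quat_conj_def fun_eq_iff)
  have comm: "q * x = x * q" for x
  proof -
    have "q * x = q * x * (qcnj q * q)" by (simp add: Sp1_qcnj_mult[OF q])
    also have "\<dots> = q * x * qcnj q * q" by (simp only: mult.assoc)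
    finally show ?thesis by (simp only: c)
  qed
  \<comment> \<open>Commuting with \<open>quat_i\<close> kills the j and k parts, commuting with
    \<open>quat_j\<close> the i and k parts; a real unit is 1 or -1.\<close>
  have im: "Qi q = 0" "Qj q = 0" "Qk q = 0"
    using comm[of quat_i] comm[of quat_j] by (simp_all add: quat_unit_defs quat_defs)
  then have "(Qre q)\<^sup>2 = 1"
    using q by (simp add: in_Sp1_iff qcnj_def quat_defs power2_eq_square)
  with im show "q \<in> Z2_H"
    by (auto simp: Z2_H_def quat_eq_iff quat_defs power2_eq_1_iff)
next
  fix q assume "q \<in> Z2_H"
  then show "q \<in> kernel Sp1 G2_H quat_conj"
    by (auto simp: Z2_H_def kernel_def in_Sp1_iff G2_H_def IsoR_H_def quat_conj_def fun_eq_iff)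
qed

lemma quat_intertwiner_exists:
  fixes f :: "quat \<Rightarrow> quat"
  assumes lin: "linear f" and mult: "\<And>x y. f (x * y) = f x * f y" and one: "f 1 = 1"
  obtains q where "q \<noteq> 0" and "\<And>x. f x * q = q * x"
proof -
  \<comment> \<open>Half the sum of \<open>f u * t * inverse u\<close> over the quaternion group: u
    and -u contribute equally, and the minus signs are the inverses of the imaginary units.\<close>
  define q where "q t = t - f quat_i * t * quat_i - f quat_j * t * quat_j - f quat_k * t * quat_k"
    for t
  have neg: "f (- x) = - f x" for x using lin by (rule linear_neg)
  have f_unit: "f x * f y = f (x * y)" "f x * (f y * z) = f (x * y) * z" for x y z
    by (simp_all add: mult mult.assoc)
  \<comment> \<open>By the multiplication table both sides consist of the same four terms in a
    different order.\<close>
  have gen: "f quat_i * q t = q t * quat_i" "f quat_j * q t = q t * quat_j"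
    "f quat_k * q t = q t * quat_k" for t
    by (simp_all add: q_def right_diff_distrib left_diff_distrib mult.assoc f_unit
        quat_unit_mult neg one)
  have inter: "f x * q t = q t * x" for x t
  proof -
    have "f x = Qre x *\<^sub>R 1 + Qi x *\<^sub>R f quat_i + Qj x *\<^sub>R f quat_j + Qk x *\<^sub>R f quat_k"
      by (subst quat_basis_expansion[of x])
        (simp only: linear_add[OF lin] linear_scale[OF lin] one)
    then have "f x * q t = q t * (Qre x *\<^sub>R 1 + Qi x *\<^sub>R quat_i + Qj x *\<^sub>R quat_j + Qk x *\<^sub>R quat_k)"
      by (simp add: distrib_left distrib_right gen)
    then show ?thesis by (simp flip: quat_basis_expansion)
  qed
  have "q 1 - q quat_i * quat_i - q quat_j * quat_j - q quat_k * quat_k = 4"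
    by (simp add: q_def left_diff_distrib distrib_right mult.assoc quat_unit_mult)
  then have "\<exists>t. q t \<noteq> 0" by (metis diff_zero mult_zero_left zero_neq_numeral)
  with inter that show thesis by blast
qed

lemma quat_conj_surj:
  assumes f: "f \<in> carrier G2_H"
  shows "f \<in> quat_conj ` carrier Sp1"
proof -
  have lin: "linear f" and bij: "bij f" and mult: "\<And>x y. f (x * y) = f x * f y"
    using f by (simp_all add: in_G2_H_iff)
  \<comment> \<open>\<open>f 1\<close> is idempotent and, by injectivity, nonzero, so it can be
    cancelled in \<open>f 1 * f 1 = f 1\<close>.\<close>
  have "f 1 \<noteq> 0"
    using bij linear_0[OF lin] by (metis bij_is_inj injD zero_neq_one)
  moreover have "f 1 * f 1 = f 1 * 1" using mult[of 1 1] by simp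
  ultimately have one: "f 1 = 1" by (simp only: mult_cancel_left) simp
  obtain q where q: "q \<noteq> 0" and inter: "\<And>x. f x * q = q * x"
    using quat_intertwiner_exists[OF lin mult one] by blast
  \<comment> \<open>\<open>qnorm2\<close> is the squared norm, hence the root. Real scalars are
    central, so rescaling keeps the intertwining relation.\<close>
  define u where "u = (1 / sqrt (qnorm2 q)) *\<^sub>R q"
  have pos: "qnorm2 q > 0"
    using q qnorm2_nonneg[of q] qnorm2_eq_0_iff[of q] by linarith
  have unit: "u * qcnj u = 1"
    using pos by (simp add: u_def qcnj_scaleR mult_qcnj)
  have "f x * u = u * x" for x
    by (simp add: u_def inter)
  then have "quat_conj u x = f x" for x
    using unit by (simp add: quat_conj_def mult.assoc flip: \<open>\<And>x. f x * u = u * x\<close>)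
  then show ?thesis
    using unit by (intro image_eqI[of _ _ u]) (simp_all add: in_Sp1_iff fun_eq_iff)
qed

theorem theorem3p3:
  shows "G2_H \<cong> Sp1 Mod Z2_H"
proof -
  interpret group_hom Sp1 G2_H quat_conj
    by (intro group_hom.intro group_Sp1 group_G2_H group_hom_axioms.intro quat_conj_hom)
  have "quat_conj ` carrier Sp1 = carrier G2_H"
    using quat_conj_in_G2_H quat_conj_surj by blast
  \<comment> \<open>First isomorphism theorem. It gives the isomorphism from the quotient to
    \<open>G2_H\<close>; reversing it uses that the quotient is a group.\<close>
  then have "Sp1 Mod Z2_H \<cong> G2_H"
    using FactGroup_iso by (simp add: quat_conj_kernel)
  moreover have "group (Sp1 Mod Z2_H)"
    by (rule normal.factorgroup_is_group[OF normal_Z2_H])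
  ultimately show ?thesis by (rule group.iso_sym[rotated])
qed

end
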